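(* Let $\ell$ be a positive integer with $q-1=\ell s$. Let $u_i>r_i>0$ be integers and $a_i\in\mathbb{F}_q^*$ such that $\gcd(u_i-r_i,q-1)=s$ for all $i=0,\ldots,\ell-1$ (the same constant $s$ for every $i$). Let $e_i:=(u_i-r_i)/s$, let $\eta$ be a fixed primitive $2\ell$-th root of unity in the algebraic closure of $\mathbb{F}_q$ with $\zeta=\eta^2$. Suppose $(\eta^{ie_i}+a_i/\eta^{ie_i})^s=1$ for each $i=0,\ldots,\ell-1$. Define $P:\mathbb{F}_q\to\mathbb{F}_q$ by $P(0)=0$ and $P(x)=x^{u_i}+a_ix^{r_i}$ if $x\in C_i$, for $0\le i\le\ell-1$. Then $P$ permutes $\mathbb{F}_q$ if and only if $-a_i\neq\zeta^{ie_i}$ and $\gcd(r_i,s)=1$ for all $0\le i\le\ell-1$, and $\{r_ii+\frac{e_isi}{2}\mid i=0,\ldots,\ell-1\}$ is a complete set of residues modulo $\ell$.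
   Context: $q$ is a prime power, $\gamma$ a fixed primitive element (generator of $\mathbb{F}_q^*$). $C_0=\{\gamma^{\ell j}: 0\le j\le s-1\}$ and $C_i=\gamma^iC_0$ for $0\le i\le\ell-1$ are the cyclotomic cosets. $\zeta=\gamma^s$ is a primitive $\ell$-th root of unity (so $\eta$ is chosen with $\eta^2=\zeta=\gamma^s$). *)

theory Defs
  imports
    "HOL-Library.Cardinality"
    "HOL-Algebra.Algebraic_Closure_Type"
    "HOL-Number_Theory.Cong"
begin

definition primitive_element :: "'a :: finite_field \<Rightarrow> bool" where
  "primitive_element g \<longleftrightarrow> range (\<lambda>k::nat. g ^ k) = UNIV - {0}"

definition primitive_unity_root :: "nat \<Rightarrow> 'a :: field \<Rightarrow> bool" where
  "primitive_unity_root n z \<longleftrightarrow> n > 0 \<and> z ^ n = 1 \<and> (\<forall>k. 0 < k \<and> k < n \<longrightarrow> z ^ k \<noteq> 1)"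

definition cyclotomic_coset :: "'a :: field \<Rightarrow> nat \<Rightarrow> nat \<Rightarrow> nat \<Rightarrow> 'a set" where
  "cyclotomic_coset g l s i = (\<lambda>x. g ^ i * x) ` {g ^ (l * j) | j. j \<le> s - 1}"

definition complete_residue_set :: "nat \<Rightarrow> int set \<Rightarrow> bool" where
  "complete_residue_set m S \<longleftrightarrow> (\<forall>a. \<exists>!x. x \<in> S \<and> [x = a] (mod int m))"

lemma primitive_unity_root_power_eq_1_imp_dvd:
  assumes "primitive_unity_root n z" "z ^ k = 1"
  shows "n dvd k"
proof -
  have n: "n > 0" "z ^ n = 1" and min: "\<And>j. 0 < j \<Longrightarrow> j < n \<Longrightarrow> z ^ j \<noteq> 1"
    using assms(1) by (auto simp: primitive_unity_root_def)
  have "z ^ k = (z ^ n) ^ (k div n) * z ^ (k mod n)"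
    unfolding power_mult[symmetric] power_add[symmetric] by simp
  hence "z ^ (k mod n) = 1"
    using assms(2) n by simp
  hence "k mod n = 0"
    using min[of "k mod n"] n by force
  thus ?thesis by auto
qed

text \<open>
  The exponents \<open>i e\<^sub>i s / 2\<close> of the theorem are integers: with \<open>n = i e\<^sub>i\<close> and \<open>a = a\<^sub>i\<close>,
  this follows from the hypothesis on \<open>s\<close>-th powers. The truncating division by 2
  is therefore exact wherever it is used.
\<close>
lemma even_half_exponent:
  fixes z a :: "'a :: finite_field" and \<eta> :: "'a alg_closure"
  assumes card: "CARD('a) - 1 = l * s"
    and root: "primitive_unity_root (2 * l) \<eta>" and sq: "\<eta> ^ 2 = to_ac z"
    and pow: "(\<eta> ^ n + to_ac a / \<eta> ^ n) ^ s = 1"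
  shows "even (n * s)"
proof -
  have l: "l > 0" and "\<eta> ^ (2 * l) = 1"
    using root by (auto simp: primitive_unity_root_def)
  hence nz: "\<eta> \<noteq> 0" by (auto simp: power_0_left)
  have "CARD('a) = Suc (l * s)"
    using card by (metis One_nat_def Suc_pred zero_less_card_finite)
  hence unit: "x ^ (l * s) = 1" if "x \<noteq> 0" for x :: 'a
    using that finite_field_power_card_eq_same[of x] by simp
  have s: "s > 0"
  proof (rule ccontr)
    assume "\<not> s > 0"
    hence "card (UNIV :: 'a set) = 1"
      using \<open>CARD('a) = Suc (l * s)\<close> by simp
    thus False
      using card_1_singletonE[of "UNIV :: 'a set"] by (metis UNIV_I singletonD zero_neq_one)
  qed
  have sq2: "\<eta> ^ n * \<eta> ^ n = to_ac z ^ n"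
    unfolding sq[symmetric] power2_eq_square by (rule power_mult_distrib[symmetric])
  define w where "w = z ^ n + a"
  have "to_ac w = \<eta> ^ n * (\<eta> ^ n + to_ac a / \<eta> ^ n)"
    using nz sq2 by (simp add: w_def distrib_left)
  hence w: "to_ac w ^ s = \<eta> ^ (n * s)"
    using pow by (simp add: power_mult_distrib power_mult)
  have "w \<noteq> 0"
    using w nz s by (auto simp: power_0_left)
  have "\<eta> ^ (n * s * l) = (to_ac w ^ s) ^ l"
    by (simp only: w power_mult)
  also have "\<dots> = to_ac (w ^ (l * s))"
    by (simp only: to_ac_power power_mult[symmetric] mult.commute)
  also have "\<dots> = 1"
    using unit[OF \<open>w \<noteq> 0\<close>] by (metis to_ac_1)
  finally have "2 * l dvd n * s * l"
    using primitive_unity_root_power_eq_1_imp_dvd[OF root] by blast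
  thus ?thesis using l by auto
qed

end

theory Submission
  imports Defs
begin

text \<open>
  On the coset \<open>C\<^sub>i\<close> the power \<open>x\<close> to the \<open>u\<^sub>i - r\<^sub>i = e\<^sub>i s\<close> is the constant \<open>\<zeta>\<close> to the \<open>i e\<^sub>i\<close>, so
  there \<open>P\<close> is the monomial \<open>w\<^sub>i x\<close> to the \<open>r\<^sub>i\<close>, with \<open>w\<^sub>i\<close> the sum of that constant and \<open>a\<^sub>i\<close>.
  Cosets are separated by the \<open>s\<close>-th power map, and the hypothesis on \<open>a\<^sub>i\<close> says that \<open>w\<^sub>i\<close> is
  nonzero with \<open>s\<close>-th power \<open>\<zeta>\<close> to the \<open>i e\<^sub>i s / 2\<close>. Hence \<open>P\<close> maps \<open>C\<^sub>i\<close> into the coset with index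
  \<open>r\<^sub>i i + i e\<^sub>i s / 2\<close> modulo \<open>l\<close>. It is bijective iff it permutes the cosets and is injective on
  each of them, and the latter means that \<open>r\<^sub>i\<close> is coprime to \<open>s\<close>.
\<close>

section \<open>Exponents of roots of unity and of primitive elements\<close>

lemma primitive_unity_root_power_eq_iff:
  assumes "primitive_unity_root n z"
  shows "z ^ i = z ^ j \<longleftrightarrow> [i = j] (mod n)"
proof -
  have n: "n > 0" "z ^ n = 1"
    using assms by (auto simp: primitive_unity_root_def)
  hence nz: "z \<noteq> 0" by (auto simp: power_0_left)
  have red: "z ^ k = z ^ (k mod n)" for k
  proof -
    have "z ^ k = (z ^ n) ^ (k div n) * z ^ (k mod n)"
      unfolding power_mult[symmetric] power_add[symmetric] by simp
    thus ?thesis using n by simp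
  qed
  have wlog: "[i = j] (mod n)" if "i \<le> j" "z ^ i = z ^ j" for i j
  proof -
    have "z ^ j = z ^ i * z ^ (j - i)"
      using that(1) by (simp flip: power_add)
    hence "z ^ (j - i) = 1" using that nz by simp
    hence "n dvd j - i"
      by (rule primitive_unity_root_power_eq_1_imp_dvd[OF assms])
    thus ?thesis using that by (metis cong_altdef_nat cong_sym)
  qed
  show ?thesis
  proof
    assume "z ^ i = z ^ j"
    thus "[i = j] (mod n)"
      using wlog[of i j] wlog[of j i] by (metis cong_sym nle_le)
  next
    assume "[i = j] (mod n)"
    thus "z ^ i = z ^ j"
      using red[of i] red[of j] by (simp add: cong_def)
  qed
qed

text \<open>If \<open>g ^ k = 1\<close> with \<open>0 < k\<close>, then every power of
  \<open>g\<close> is one of the first \<open>k\<close>. These are too few to exhaust the nonzero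
  elements when \<open>k < CARD('a) - 1\<close>.\<close>

lemma primitive_element_imp_unity_root:
  fixes g :: "'a :: finite_field"
  assumes "primitive_element g"
  shows "primitive_unity_root (CARD('a) - 1) g"
proof -
  define n where "n = CARD('a) - 1"
  have range: "range (\<lambda>k::nat. g ^ k) = UNIV - {0}"
    using assms by (simp add: primitive_element_def)
  hence nz: "g \<noteq> 0"
    by (metis DiffD2 insertI1 power_one_right rangeI)
  have card: "card (UNIV - {0 :: 'a}) = n"
    by (simp add: n_def card_Diff_singleton)
  have "n > 0"
    using card range by (metis card_gt_0_iff finite_Diff finite_class.finite_UNIV image_is_empty UNIV_not_empty)
  have "g * g ^ n = g"
    using finite_field_power_card_eq_same[of g] by (simp add: n_def flip: power_Suc)
  hence one: "g ^ n = 1" using nz by simp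
  have "g ^ k \<noteq> 1" if k: "0 < k" "k < n" for k
  proof
    assume eq: "g ^ k = 1"
    have "range (\<lambda>j::nat. g ^ j) \<subseteq> (\<lambda>j. g ^ j) ` {..<k}"
    proof safe
      fix j
      have "g ^ j = (g ^ k) ^ (j div k) * g ^ (j mod k)"
        unfolding power_mult[symmetric] power_add[symmetric] by simp
      thus "g ^ j \<in> (\<lambda>j. g ^ j) ` {..<k}" using eq k by auto
    qed
    hence "n \<le> card ((\<lambda>j. g ^ j) ` {..<k})"
      unfolding range card[symmetric] by (rule card_mono[rotated]) simp
    also have "\<dots> \<le> k"
      using card_image_le[of "{..<k}" "\<lambda>j. g ^ j"] by simp
    finally show False using k by simp
  qed
  thus ?thesis
    using \<open>n > 0\<close> one unfolding primitive_unity_root_def n_def[symmetric] by blast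
qed

section \<open>Cyclotomic cosets as fibres of the \<open>s\<close>-th power map\<close>

text \<open>For \<open>x = g ^ k\<close> the value \<open>x ^ s\<close> determines
  \<open>k * s\<close> modulo the order \<open>l * s\<close> of \<open>g\<close>. Cancelling
  \<open>s\<close> leaves \<open>k\<close> modulo \<open>l\<close>, which is the index of the
  coset.\<close>

lemma mem_cyclotomic_coset_iff:
  fixes g :: "'a :: finite_field"
  assumes g: "primitive_element g" and card: "CARD('a) - 1 = l * s" and i: "i < l"
  shows "x \<in> cyclotomic_coset g l s i \<longleftrightarrow> x \<noteq> 0 \<and> x ^ s = (g ^ s) ^ i"
proof -
  note root = primitive_element_imp_unity_root[OF g, unfolded card]
  have pos: "l * s > 0" and one: "g ^ (l * s) = 1"
    using root by (auto simp: primitive_unity_root_def)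
  hence nz: "g \<noteq> 0" by (auto simp: power_0_left)
  show ?thesis
  proof
    assume "x \<in> cyclotomic_coset g l s i"
    then obtain j where x: "x = g ^ i * g ^ (l * j)"
      by (auto simp: cyclotomic_coset_def)
    have "x ^ s = (g ^ s) ^ i * (g ^ (l * s)) ^ j"
      unfolding x by (simp add: power_mult_distrib mult_ac flip: power_mult)
    thus "x \<noteq> 0 \<and> x ^ s = (g ^ s) ^ i"
      using x nz one by simp
  next
    assume x: "x \<noteq> 0 \<and> x ^ s = (g ^ s) ^ i"
    then obtain k' where k': "x = g ^ k'"
      using g unfolding primitive_element_def by (metis DiffI UNIV_I imageE singletonD)
    \<comment> \<open>Reducing modulo the order of \<open>g\<close> brings \<open>k div l\<close>
      into the index range up to \<open>s - 1\<close> used in the definition of the coset.\<close>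
    define k where "k = k' mod (l * s)"
    have "x = g ^ k"
      unfolding k' by (subst primitive_unity_root_power_eq_iff[OF root]) (simp add: k_def cong_def)
    have "k < l * s" using pos by (simp add: k_def)
    have "g ^ (k * s) = g ^ (i * s)"
      using x by (simp add: \<open>x = g ^ k\<close> mult.commute flip: power_mult)
    hence "[k * s = i * s] (mod (l * s))"
      by (simp add: primitive_unity_root_power_eq_iff[OF root])
    hence "k mod l = i"
      using pos i by (simp add: cong_def mod_mult_mult2)
    hence "k = i + l * (k div l)" by (metis mod_mult_div_eq)
    have "k div l \<le> s - 1"
      using \<open>k < l * s\<close> by (metis less_mult_imp_div_less mult.commute Suc_pred' less_Suc_eq_le pos nat_0_less_mult_iff)
    moreover have "x = g ^ i * g ^ (l * (k div l))"
      unfolding \<open>x = g ^ k\<close> power_add[symmetric] using \<open>k = i + l * (k div l)\<close> by simp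
    ultimately show "x \<in> cyclotomic_coset g l s i"
      unfolding cyclotomic_coset_def by blast
  qed
qed

lemma cyclotomic_cosets_cover:
  fixes g :: "'a :: finite_field"
  assumes g: "primitive_element g" and card: "CARD('a) - 1 = l * s" and x: "x \<noteq> 0"
  obtains i where "i < l" "x \<in> cyclotomic_coset g l s i"
proof -
  note root = primitive_element_imp_unity_root[OF g, unfolded card]
  obtain k where k: "x = g ^ k"
    using g x unfolding primitive_element_def by (metis DiffI UNIV_I imageE singletonD)
  have "l > 0" using root by (auto simp: primitive_unity_root_def)
  have "[k * s = (k mod l) * s] (mod (l * s))"
    by (simp add: cong_def mod_mult_mult2)
  hence "g ^ (k * s) = g ^ ((k mod l) * s)"
    by (simp add: primitive_unity_root_power_eq_iff[OF root])
  hence "x ^ s = (g ^ s) ^ (k mod l)"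
    unfolding k by (simp add: mult.commute flip: power_mult)
  thus ?thesis
    using that[of "k mod l"] mem_cyclotomic_coset_iff[OF g card, of "k mod l" x] x \<open>l > 0\<close> by simp
qed

section \<open>Complete residue systems\<close>

text \<open>Equal values at two indices merge in the set and do not violate uniqueness there.
  Injectivity comes from existence instead: \<open>l\<close> indices must reach \<open>l\<close>
  classes. Conversely, an injective self-map of \<open>{..<l}\<close> is onto, which gives
  existence.\<close>

lemma complete_residue_set_iff_inj_on:
  assumes "l > 0"
  shows "complete_residue_set l {int (f i) | i. i < l} \<longleftrightarrow> inj_on (\<lambda>i. f i mod l) {..<l}"
    (is "?C \<longleftrightarrow> inj_on ?f _")
proof
  assume C: ?C
  have "{..<l} \<subseteq> ?f ` {..<l}"
  proof
    fix m assume m: "m \<in> {..<l}"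
    obtain i where i: "i < l" "[int (f i) = int m] (mod int l)"
      using C unfolding complete_residue_set_def by blast
    hence "[f i = m] (mod l)" by (simp add: cong_int_iff)
    hence "?f i = m" using m by (simp add: cong_def)
    thus "m \<in> ?f ` {..<l}" using i by blast
  qed
  moreover have "?f ` {..<l} \<subseteq> {..<l}" using assms by auto
  ultimately show "inj_on ?f {..<l}"
    by (intro eq_card_imp_inj_on) auto
next
  assume inj: "inj_on ?f {..<l}"
  have "?f ` {..<l} \<subseteq> {..<l}" using assms by auto
  hence surj: "?f ` {..<l} = {..<l}"
    using inj by (simp add: endo_inj_surj)
  show ?C
    unfolding complete_residue_set_def
  proof (intro allI ex_ex1I)
    fix b :: int
    have "nat (b mod int l) \<in> {..<l}"
      using assms by (simp add: nat_less_iff)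
    then obtain i where i: "i < l" "?f i = nat (b mod int l)"
      using surj by (metis (no_types, lifting) imageE lessThan_iff)
    hence "int (f i) mod int l = b mod int l"
      using assms by (metis zmod_int int_nat_eq pos_mod_sign of_nat_0_less_iff)
    thus "\<exists>x. x \<in> {int (f i) | i. i < l} \<and> [x = b] (mod int l)"
      using i by (auto simp: cong_def)
  next
    fix b x y
    assume "x \<in> {int (f i) | i. i < l} \<and> [x = b] (mod int l)"
      and "y \<in> {int (f i) | i. i < l} \<and> [y = b] (mod int l)"
    then obtain i j where ij: "i < l" "j < l" "x = int (f i)" "y = int (f j)"
      and "[int (f i) = int (f j)] (mod int l)"
      using cong_trans cong_sym by blast
    hence "[f i = f j] (mod l)" by (simp only: cong_int_iff)
    hence "?f i = ?f j" by (simp only: cong_def)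
    thus "x = y" using inj ij by (auto dest: inj_onD)
  qed
qed

section \<open>Maps that are monomial on each coset\<close>

text \<open>Here \<open>m i\<close> is the index, modulo \<open>l\<close>, of the coset containing
  the coefficient \<open>w i\<close>. Only this index matters, so the criterion needs no square root
  of \<open>g ^ s\<close>.\<close>

lemma bij_cyclotomic_monomial_iff:
  fixes g :: "'a :: finite_field" and P :: "'a \<Rightarrow> 'a"
  assumes g: "primitive_element g" and card: "CARD('a) - 1 = l * s"
    and P0: "P 0 = 0"
    and P: "\<And>i x. i < l \<Longrightarrow> x \<in> cyclotomic_coset g l s i \<Longrightarrow> P x = w i * x ^ r i"
    and w: "\<And>i. i < l \<Longrightarrow> w i \<noteq> 0" "\<And>i. i < l \<Longrightarrow> w i ^ s = (g ^ s) ^ m i"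
  shows "bij P \<longleftrightarrow>
    (\<forall>i<l. gcd (r i) s = 1) \<and> inj_on (\<lambda>i. (r i * i + m i) mod l) {..<l}"
    (is "_ \<longleftrightarrow> _ \<and> inj_on ?k _")
proof -
  note root = primitive_element_imp_unity_root[OF g, unfolded card]
  note mem = mem_cyclotomic_coset_iff[OF g card]
  have pos: "l > 0" "s > 0" and one: "g ^ (l * s) = 1"
    using root by (auto simp: primitive_unity_root_def)
  hence nz: "g \<noteq> 0" by (auto simp: power_0_left)
  \<comment> \<open>\<open>g ^ s\<close> has order \<open>l\<close>, so its exponents count modulo
    \<open>l\<close>.\<close>
  have pow_s: "(g ^ s) ^ i = (g ^ s) ^ j \<longleftrightarrow> i mod l = j mod l" for i j
    unfolding power_mult[symmetric] primitive_unity_root_power_eq_iff[OF root]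
    using pos by (simp add: cong_def mod_mult_mult1 mult.commute[of l s])
  \<comment> \<open>By the criterion \<open>mem\<close>, these two facts put \<open>P x\<close> into
    the coset with index \<open>?k i\<close>.\<close>
  have Ps: "P x ^ s = (g ^ s) ^ (r i * i + m i)" and Pnz: "P x \<noteq> 0"
    if i: "i < l" "x \<in> cyclotomic_coset g l s i" for i x
  proof -
    have x: "x \<noteq> 0" "x ^ s = (g ^ s) ^ i" using i mem by auto
    have "P x ^ s = (x ^ s) ^ r i * w i ^ s"
      by (simp add: P[OF i] power_mult_distrib mult.commute flip: power_mult)
    also have "\<dots> = (g ^ s) ^ (r i * i + m i)"
      unfolding x(2) w(2)[OF i(1)] by (simp add: power_add mult_ac flip: power_mult)
    finally show "P x ^ s = (g ^ s) ^ (r i * i + m i)" .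
    show "P x \<noteq> 0" using P[OF i] w(1) i x by simp
  qed
  show ?thesis
  proof (intro iffI conjI allI impI)
    assume bij: "bij P"
    fix i assume i: "i < l"
    show "gcd (r i) s = 1"
    proof (rule ccontr)
      assume "gcd (r i) s \<noteq> 1"
      then obtain d where d: "d = gcd (r i) s" "d > 1"
        using pos by (metis gcd_pos_nat less_one linorder_neqE_nat not_gr_zero)
      then obtain b c where b: "r i = d * b" and c: "s = d * c"
        by (metis dvdE gcd_dvd1 gcd_dvd2)
      have c': "0 < c" using c pos(2) by (cases c) auto
      hence c'': "c < s" using c d(2) by simp
      \<comment> \<open>Two distinct points of one coset with the same image: the
        \<open>d\<close>-th power of their ratio \<open>g ^ (l * c)\<close> is
        \<open>g ^ (l * s) = 1\<close>, and \<open>d\<close> divides \<open>r i\<close>, so their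
        \<open>r i\<close>-th powers agree. They differ because \<open>0 < c < s\<close>.\<close>
      let ?x = "g ^ i" and ?y = "g ^ (i + l * c)"
      have x: "?x \<in> cyclotomic_coset g l s i"
        using mem[OF i] nz by (simp add: mult.commute flip: power_mult)
      have "c \<le> s - 1" using c'' by simp
      hence y: "?y \<in> cyclotomic_coset g l s i"
        unfolding cyclotomic_coset_def power_add by blast
      have "?y ^ r i = ?x ^ r i * (g ^ (l * s)) ^ b"
        unfolding b c by (simp add: power_mult_distrib power_add mult_ac flip: power_mult)
      hence "P ?x = P ?y" using P[OF i x] P[OF i y] one by simp
      hence "g ^ i = g ^ (i + l * c)" using bij by (meson bij_is_inj injD)
      hence "[0 + i = l * c + i] (mod (l * s))"
        unfolding primitive_unity_root_power_eq_iff[OF root] by (simp add: add.commute)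
      hence "[0 = l * c] (mod (l * s))" by (simp only: cong_add_rcancel_nat)
      thus False using c' c'' pos by (simp add: cong_def)
    qed
  next
    assume bij: "bij P"
    \<comment> \<open>On a finite index set it suffices that \<open>?k\<close> is onto. A preimage
      of \<open>g ^ n\<close> lies in some coset, and its index is sent to \<open>n\<close>.\<close>
    have "{..<l} \<subseteq> ?k ` {..<l}"
    proof
      fix n assume n: "n \<in> {..<l}"
      obtain x where x: "P x = g ^ n" using bij by (metis bij_pointE)
      have "x \<noteq> 0" using x nz P0 by auto
      then obtain i where i: "i < l" "x \<in> cyclotomic_coset g l s i"
        using cyclotomic_cosets_cover[OF g card] by blast
      have "(g ^ s) ^ (r i * i + m i) = (g ^ s) ^ n"
        using Ps[OF i] x by (simp add: mult.commute flip: power_mult)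
      hence "?k i = n" using pow_s n by simp
      thus "n \<in> ?k ` {..<l}" using i by blast
    qed
    moreover have "?k ` {..<l} \<subseteq> {..<l}" using pos by auto
    ultimately show "inj_on ?k {..<l}"
      by (intro eq_card_imp_inj_on) auto
  next
    assume asm: "(\<forall>i<l. gcd (r i) s = 1) \<and> inj_on ?k {..<l}"
    have "inj P"
    proof (rule injI)
      fix x y assume eq: "P x = P y"
      show "x = y"
      proof (cases "x = 0 \<or> y = 0")
        case True
        thus ?thesis
          using eq P0 Pnz cyclotomic_cosets_cover[OF g card] by metis
      next
        case False
        obtain i where i: "i < l" "x \<in> cyclotomic_coset g l s i"
          using cyclotomic_cosets_cover[OF g card] False by blast
        obtain j where j: "j < l" "y \<in> cyclotomic_coset g l s j"
          using cyclotomic_cosets_cover[OF g card] False by blast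
        have "?k i = ?k j"
          using eq Ps[OF i] Ps[OF j] pow_s by metis
        hence "j = i" using asm i j by (auto dest: inj_onD)
        note j = j[unfolded this]
        have "x ^ r i = y ^ r i"
          using eq P[OF i] P[OF j] w(1)[OF i(1)] by simp
        hence r1: "(x / y) ^ r i = 1" using False by (simp add: power_divide)
        have "x ^ s = y ^ s" using i j mem by simp
        hence s1: "(x / y) ^ s = 1" using False by (simp add: power_divide)
        \<comment> \<open>Both the \<open>s\<close>-th and the \<open>r i\<close>-th power of
          \<open>x / y\<close> are 1. Bezout gives natural multiples of \<open>s\<close> and
          \<open>r i\<close> differing by 1, so \<open>x / y\<close> itself is 1.\<close>
        have "gcd s (r i) = 1" using asm i by (simp add: gcd.commute)
        then obtain b c where bc: "s * b = r i * c + 1"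
          using bezout_nat[of s "r i"] pos by auto
        have "(x / y) ^ (s * b) = (x / y) ^ (r i * c) * (x / y)"
          unfolding bc by simp
        hence "x / y = 1" unfolding power_mult r1 s1 by simp
        thus ?thesis using False by simp
      qed
    qed
    thus "bij P" by (simp add: bij_def finite_UNIV_inj_surj)
  qed
qed

section \<open>Reduction of the binomials to monomials\<close>

theorem theorem3p8:
  fixes \<gamma> \<zeta> :: "'a :: finite_field"
    and \<eta> :: "'a alg_closure"
    and l s :: nat
    and u r e :: "nat \<Rightarrow> nat"
    and a :: "nat \<Rightarrow> 'a"
    and P :: "'a \<Rightarrow> 'a"
  assumes "primitive_element \<gamma>"
    and "l > 0" and "CARD('a) - 1 = l * s"
    and "\<And>i. i < l \<Longrightarrow> u i > r i \<and> r i > 0"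
    and "\<And>i. i < l \<Longrightarrow> a i \<noteq> 0"
    and "\<And>i. i < l \<Longrightarrow> gcd (u i - r i) (CARD('a) - 1) = s"
    and "\<And>i. i < l \<Longrightarrow> e i = (u i - r i) div s"
    and "\<zeta> = \<gamma> ^ s"
    and "primitive_unity_root (2 * l) \<eta>" and "\<eta> ^ 2 = to_ac \<zeta>"
    and "\<And>i. i < l \<Longrightarrow> (\<eta> ^ (i * e i) + to_ac (a i) / \<eta> ^ (i * e i)) ^ s = 1"
    and "P 0 = 0"
    and "\<And>i x. i < l \<Longrightarrow> x \<in> cyclotomic_coset \<gamma> l s i \<Longrightarrow> P x = x ^ u i + a i * x ^ r i"
  shows "bij P \<longleftrightarrow>
    (\<forall>i<l. - a i \<noteq> \<zeta> ^ (i * e i) \<and> gcd (r i) s = 1) \<and>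
    complete_residue_set l {int (r i * i + (e i * s * i) div 2) | i. i < l}"
proof -
  note g = assms(1) and card = assms(3) and sq = assms(10)
  define w where "w i = \<zeta> ^ (i * e i) + a i" for i
  have "l * s > 0"
    using primitive_element_imp_unity_root[OF g] unfolding card primitive_unity_root_def by blast
  hence s: "s > 0" by simp
  have nz: "\<eta> \<noteq> 0"
    using assms(9) by (auto simp: primitive_unity_root_def power_0_left)
  \<comment> \<open>In the algebraic closure, pull \<open>\<eta> ^ (i * e i)\<close> out of
    \<open>w i\<close>; the remaining factor has \<open>s\<close>-th power 1 by hypothesis. The
    resulting exponent of \<open>\<eta>\<close> is even, so this is a power of
    \<open>\<zeta>\<close>, and injectivity of \<open>to_ac\<close> returns the identity to the base
    field.\<close>
  have ws: "w i ^ s = (\<gamma> ^ s) ^ ((e i * s * i) div 2)" if i: "i < l" for i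
  proof -
    have "\<eta> ^ (i * e i) * \<eta> ^ (i * e i) = to_ac \<zeta> ^ (i * e i)"
      unfolding sq[symmetric] power2_eq_square by (rule power_mult_distrib[symmetric])
    hence "to_ac (w i) = \<eta> ^ (i * e i) * (\<eta> ^ (i * e i) + to_ac (a i) / \<eta> ^ (i * e i))"
      using nz by (simp add: w_def distrib_left)
    hence "to_ac (w i) ^ s = \<eta> ^ (i * e i * s)"
      using assms(11)[OF i] by (simp add: power_mult_distrib power_mult)
    also have "i * e i * s = 2 * ((e i * s * i) div 2)"
      using even_half_exponent[OF card assms(9) sq assms(11)[OF i]] by (simp add: mult_ac)
    also have "\<eta> ^ \<dots> = to_ac \<zeta> ^ ((e i * s * i) div 2)"
      by (simp only: power_mult sq)
    finally have "to_ac (w i ^ s) = to_ac (\<zeta> ^ ((e i * s * i) div 2))" by simp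
    thus ?thesis unfolding assms(8) to_ac_eq_iff .
  qed
  \<comment> \<open>The \<open>s\<close>-th power of \<open>w i\<close> is a power of
    \<open>\<gamma>\<close>, so \<open>\<gamma> \<noteq> 0\<close> makes \<open>w i\<close>
    nonzero.\<close>
  have "\<gamma> \<noteq> 0"
    using nz sq s assms(8) by (auto simp: power_0_left)
  hence w0: "w i \<noteq> 0" if "i < l" for i
    using ws[OF that] s by (metis power_not_zero power_0_left not_gr_zero)
  have Pw: "P x = w i * x ^ r i" if i: "i < l" "x \<in> cyclotomic_coset \<gamma> l s i" for i x
  proof -
    have "s dvd u i - r i" using assms(6)[OF i(1)] by (metis gcd_dvd1)
    hence "u i = s * e i + r i" using assms(4,7)[OF i(1)] by simp
    hence "x ^ u i = (x ^ s) ^ e i * x ^ r i" by (simp add: power_add power_mult)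
    also have "x ^ s = \<zeta> ^ i"
      using mem_cyclotomic_coset_iff[OF g card i(1)] i(2) assms(8) by simp
    finally show ?thesis
      using assms(13)[OF i] by (simp add: w_def distrib_right power_mult)
  qed
  \<comment> \<open>This is \<open>w i \<noteq> 0\<close> rewritten.\<close>
  have neq: "- a i \<noteq> \<zeta> ^ (i * e i)" if "i < l" for i
    using w0[OF that] unfolding w_def by (metis add.left_inverse)
  have "bij P \<longleftrightarrow> (\<forall>i<l. gcd (r i) s = 1) \<and>
      inj_on (\<lambda>i. (r i * i + (e i * s * i) div 2) mod l) {..<l}"
    using g card assms(12) Pw w0 ws by (rule bij_cyclotomic_monomial_iff)
  thus ?thesis
    unfolding complete_residue_set_iff_inj_on[OF assms(2)] using neq by blast
qed

end
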